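(* Let $q$ and $s$ be indeterminates and consider linear operators on the space of polynomials in $x$. Let $X$ be multiplication by $x$, $D_q$ the $q$-differentiation operator $D_qf(x)=\frac{f(qx)-f(x)}{(q-1)x}$, and for a polynomial $g$ let $g(X)$ be multiplication by $g(x)$. Define $$h_n(x,s)=\sum_{j=0}^{\lfloor n/2\rfloor} q^{j^2}s^j\frac{[n]!}{(1+q)(1+q^2)\cdots(1+q^j)\,[j]!\,[n-2j]!}x^{n-2j}.$$ Then for every $n\ge0$, $$(X+qsD_q)(X+q^3sD_q)\cdots(X+q^{2n-1}sD_q)=\sum_{k=0}^n\begin{bmatrix} n\\ k\end{bmatrix}q^{kn}\,h_{n-k}(X,s)\,(sD_q)^k.$$
   Context: Notation: $[n]=1+q+\cdots+q^{n-1}$, $[n]!=[1][2]\cdots[n]$ with $[0]!=1$, and $\begin{bmatrix} n\\ k\end{bmatrix}=\frac{[n]!}{[k]![n-k]!}$ is the $q$-binomial coefficient. For $n=0$ the left-hand product is the identity operator. *)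

theory Defs
  imports "HOL-Computational_Algebra.Polynomial_Factorial"
begin

text \<open>
  The indeterminates live in the field of rational functions \<open>k(q, s)\<close>, realised as the fraction
  field of \<open>k[q][s]\<close> for an arbitrary field \<open>k\<close>; the operators act on polynomials in \<open>x\<close> over
  this field.
\<close>

definition q_indet :: "'k::field poly poly fract" where
  "q_indet = to_fract [:[:0, 1:]:]"

definition s_indet :: "'k::field poly poly fract" where
  "s_indet = to_fract [:0, 1:]"

definition q_number :: "'a::field \<Rightarrow> nat \<Rightarrow> 'a" where
  "q_number q n = (\<Sum>i<n. q ^ i)"

definition q_factorial :: "'a::field \<Rightarrow> nat \<Rightarrow> 'a" where
  "q_factorial q n = (\<Prod>i=1..n. q_number q i)"

definition q_binomial :: "'a::field \<Rightarrow> nat \<Rightarrow> nat \<Rightarrow> 'a" where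
  "q_binomial q n k = q_factorial q n / (q_factorial q k * q_factorial q (n - k))"

definition mult_op :: "'a::field poly \<Rightarrow> 'a poly \<Rightarrow> 'a poly" where
  "mult_op g f = g * f"

text \<open>The polynomial division in the next definition is exact for \<open>q \<noteq> 1\<close>, see \<open>q_diff_exact\<close>.\<close>

definition q_diff :: "'a::field \<Rightarrow> 'a poly \<Rightarrow> 'a poly" where
  "q_diff q f = (pcompose f [:0, q:] - f) div [:0, q - 1:]"

lemma q_diff_exact:
  fixes q :: "'a::field"
  assumes "q \<noteq> 1"
  shows "[:0, q - 1:] * q_diff q f = pcompose f [:0, q:] - f"
proof -
  have "[:0, 1:] dvd pcompose f [:0, q:] - f"
    using dvd_iff_poly_eq_0[of 0 "pcompose f [:0, q:] - f"] by (simp add: poly_pcompose)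
  moreover have "[:0, q - 1:] = smult (q - 1) [:0, 1:]"
    by simp
  ultimately have "[:0, q - 1:] dvd pcompose f [:0, q:] - f"
    using assms by (simp only: smult_dvd_iff) simp
  then show ?thesis
    unfolding q_diff_def by (rule dvd_mult_div_cancel)
qed

lemma q_indet_neq_1: "(q_indet :: 'k::field poly poly fract) \<noteq> 1"
proof
  assume "(q_indet :: 'k poly poly fract) = 1"
  then have "to_fract [:[:0, 1 :: 'k:]:] = to_fract 1"
    by (simp add: q_indet_def)
  then show False
    by (simp only: to_fract_eq_iff) (simp add: one_pCons)
qed

definition h_poly :: "'a::field \<Rightarrow> 'a \<Rightarrow> nat \<Rightarrow> 'a poly" where
  "h_poly q s n = (\<Sum>j=0..n div 2.
     monom (q ^ j\<^sup>2 * s ^ j *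
       (q_factorial q n /
         ((\<Prod>i=1..j. 1 + q ^ i) * q_factorial q j * q_factorial q (n - 2 * j)))) (n - 2 * j))"

text \<open>The composition of a list of operators, the last one being applied first.\<close>

definition op_prod :: "('b \<Rightarrow> 'b) list \<Rightarrow> 'b \<Rightarrow> 'b" where
  "op_prod Ts = foldr (\<circ>) Ts id"

end

theory Submission
  imports Defs
begin

text \<open>
  Induction on \<open>n\<close>, multiplying by the next factor \<open>X + q\<^bsup>2n+1\<^esup>sD\<close> on the right. The commutation rule
  \<open>D\<^sup>k X = q\<^sup>k X D\<^sup>k + [k] D\<^bsup>k-1\<^esup>\<close> moves the new \<open>X\<close> to the left; comparing the coefficients of
  \<open>(sD)\<^sup>k\<close> and using the \<open>q\<close>-Pascal rule, what remains is the three-term recurrence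
  \<open>h\<^bsub>m+1\<^esub> = x h\<^sub>m + q\<^sup>m [m] s h\<^bsub>m-1\<^esub>\<close>, which in turn comes down to \<open>[2j] = (1 + q\<^sup>j)[j]\<close>.
\<close>

section \<open>q-numbers and q-factorials\<close>

lemma q_number_0 [simp]: "q_number q 0 = 0"
  by (simp add: q_number_def)

lemma q_number_1 [simp]: "q_number q (Suc 0) = 1"
  by (simp add: q_number_def)

lemma q_number_Suc: "q_number q (Suc n) = q_number q n + q ^ n"
  by (simp add: q_number_def)

lemma q_number_add: "q_number q (m + n) = q_number q m + q ^ m * q_number q n"
  by (induction n) (simp_all add: q_number_Suc power_add algebra_simps)

lemma q_number_double: "q_number q (2 * n) = (1 + q ^ n) * q_number q n"
  unfolding mult_2 q_number_add by (simp add: algebra_simps)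

lemma q_number_mult_diff: "(q - 1) * q_number q n = q ^ n - 1"
  by (induction n) (simp_all add: q_number_Suc algebra_simps)

lemma q_factorial_0 [simp]: "q_factorial q 0 = 1"
  by (simp add: q_factorial_def)

lemma q_factorial_Suc: "q_factorial q (Suc n) = q_number q (Suc n) * q_factorial q n"
  by (simp add: q_factorial_def mult.commute)

section \<open>The q-derivative and its commutation with X\<close>

lemma coeff_pcompose_linear: "coeff (pcompose f [:0, c:]) n = c ^ n * coeff f n"
  for c :: "'a::comm_ring_1"
  by (induction f arbitrary: n)
    (auto simp: pcompose_pCons coeff_pCons split: nat.splits)

lemma coeff_q_diff:
  assumes "q \<noteq> 1"
  shows "coeff (q_diff q f) n = q_number q (Suc n) * coeff f (Suc n)"
proof -
  have "(q - 1) * coeff (q_diff q f) n = coeff ([:0, q - 1:] * q_diff q f) (Suc n)"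
    by simp
  also have "\<dots> = (q ^ Suc n - 1) * coeff f (Suc n)"
    unfolding q_diff_exact[OF assms] by (simp add: coeff_pcompose_linear algebra_simps)
  also have "\<dots> = (q - 1) * (q_number q (Suc n) * coeff f (Suc n))"
    by (simp only: q_number_mult_diff[symmetric] mult.assoc)
  finally show ?thesis
    using assms by simp
qed

lemma q_diff_add: "q \<noteq> 1 \<Longrightarrow> q_diff q (f + g) = q_diff q f + q_diff q g"
  by (rule poly_eqI) (simp add: coeff_q_diff algebra_simps)

lemma q_diff_smult: "q \<noteq> 1 \<Longrightarrow> q_diff q (smult c f) = smult c (q_diff q f)"
  by (rule poly_eqI) (simp add: coeff_q_diff)

text \<open>Since \<open>pCons 0\<close> is the operator X, this is D X = 1 + q X D; on coefficients
  it is [n+1] = 1 + q [n].\<close>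

lemma q_diff_pCons_0: "q \<noteq> 1 \<Longrightarrow> q_diff q (pCons 0 f) = f + smult q (pCons 0 (q_diff q f))"
  using q_number_add[of q 1]
  by (intro poly_eqI) (auto simp: coeff_q_diff coeff_pCons algebra_simps split: nat.splits)

definition scaled_q_diff :: "'a::field \<Rightarrow> 'a \<Rightarrow> 'a poly \<Rightarrow> 'a poly" where
  "scaled_q_diff q s g = smult s (q_diff q g)"

lemma scaled_q_diff_pow_add:
  "q \<noteq> 1 \<Longrightarrow> (scaled_q_diff q s ^^ k) (f + g) = (scaled_q_diff q s ^^ k) f + (scaled_q_diff q s ^^ k) g"
  by (induction k) (simp_all add: scaled_q_diff_def q_diff_add smult_add_right)

lemma scaled_q_diff_pow_smult:
  "q \<noteq> 1 \<Longrightarrow> (scaled_q_diff q s ^^ k) (smult c f) = smult c ((scaled_q_diff q s ^^ k) f)"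
  by (induction k) (simp_all add: scaled_q_diff_def q_diff_smult mult.commute)

text \<open>Applying sD once more to X (sD)^k f contributes a further q^k s (sD)^k f, and [k] + q^k
  = [k+1]. For k = 0 the truncated exponent \<open>k - 1\<close> is harmless because [0] =
  0.\<close>

lemma scaled_q_diff_pow_pCons_0:
  assumes "q \<noteq> 1"
  shows "(scaled_q_diff q s ^^ k) (pCons 0 f) = smult (q ^ k) (pCons 0 ((scaled_q_diff q s ^^ k) f))
    + smult (s * q_number q k) ((scaled_q_diff q s ^^ (k - 1)) f)"
proof (induction k)
  case (Suc k)
  show ?case
    using Suc assms
    by (cases k; intro poly_eqI)
      (simp_all add: scaled_q_diff_def q_diff_add q_diff_smult q_diff_pCons_0 q_number_Suc
        coeff_pCons algebra_simps split: nat.splits)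
qed simp

text \<open>The explicit zero lets sums for different n share one index range; the bare formula
  would not vanish there, as \<open>n - 2 * j\<close> truncates to 0 and [0]! = 1.\<close>

definition h_coeff :: "'a::field \<Rightarrow> 'a \<Rightarrow> nat \<Rightarrow> nat \<Rightarrow> 'a" where
  "h_coeff q s n j = (if 2 * j \<le> n then q ^ j\<^sup>2 * s ^ j *
    (q_factorial q n / ((\<Prod>i=1..j. 1 + q ^ i) * q_factorial q j * q_factorial q (n - 2 * j))) else 0)"

lemma h_poly_eq_sum:
  assumes "n \<le> N"
  shows "h_poly q s n = (\<Sum>j\<le>N. monom (h_coeff q s n j) (n - 2 * j))"
proof -
  have "h_poly q s n = (\<Sum>j=0..n div 2. monom (h_coeff q s n j) (n - 2 * j))"
    unfolding h_poly_def h_coeff_def by (intro sum.cong) auto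
  also have "\<dots> = (\<Sum>j\<le>N. monom (h_coeff q s n j) (n - 2 * j))"
    using assms by (intro sum.mono_neutral_left) (auto simp: h_coeff_def)
  finally show ?thesis .
qed

text \<open>The case distinction is needed because \<open>q_binomial q n k\<close> is not \<open>0\<close> for \<open>k > n\<close>.\<close>

definition op_coeff :: "'a::field \<Rightarrow> 'a \<Rightarrow> nat \<Rightarrow> nat \<Rightarrow> 'a poly" where
  "op_coeff q s n k =
    (if k \<le> n then smult (q_binomial q n k * q ^ (k * n)) (h_poly q s (n - k)) else 0)"

section \<open>Identities for q with [n] nonzero for all n > 0\<close>

context
  fixes q :: "'a::field"
  assumes q_number_nonzero: "\<And>n. n > 0 \<Longrightarrow> q_number q n \<noteq> 0"
begin

lemma q_factorial_nonzero: "q_factorial q n \<noteq> 0"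
  using q_number_nonzero by (auto simp: q_factorial_def)

lemma one_plus_q_pow_nonzero: "n > 0 \<Longrightarrow> 1 + q ^ n \<noteq> 0"
  using q_number_nonzero[of "2 * n"] by (auto simp: q_number_double)

lemma q_binomial_0 [simp]: "q_binomial q n 0 = 1"
  by (simp add: q_binomial_def q_factorial_nonzero)

lemma q_binomial_self [simp]: "q_binomial q n n = 1"
  by (simp add: q_binomial_def q_factorial_nonzero)

lemma q_binomial_Suc_Suc:
  assumes "k < n"
  shows "q_binomial q (Suc n) (Suc k) = q_binomial q n (Suc k) + q ^ (n - k) * q_binomial q n k"
proof -
  obtain d where n: "n = Suc (k + d)"
    using assms by (metis less_iff_Suc_add)
  have "q_number q (Suc n) = q_number q (Suc d) + q ^ Suc d * q_number q (Suc k)"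
    using q_number_add[of q "Suc d" "Suc k"] by (simp add: n add.commute)
  then show ?thesis
    using q_factorial_nonzero[of k] q_factorial_nonzero[of d]
      q_number_nonzero[of "Suc k"] q_number_nonzero[of "Suc d"]
    unfolding q_binomial_def q_factorial_Suc[of q n]
    by (simp add: n q_factorial_Suc[of q k] q_factorial_Suc[of q d] Suc_diff_le divide_simps)
      (simp add: algebra_simps)
qed

text \<open>Both sides equal [n]! / ([k]! [n-k-1]!). This turns the [k+1] produced by commutation
  into the [n-k] that the recurrence for h requires.\<close>

lemma q_binomial_absorb:
  assumes "k < n"
  shows "q_binomial q n (Suc k) * q_number q (Suc k) = q_binomial q n k * q_number q (n - k)"
proof -
  obtain d where n: "n = Suc (k + d)"
    using assms by (metis less_iff_Suc_add)
  show ?thesis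
    using q_factorial_nonzero[of k] q_factorial_nonzero[of d]
      q_number_nonzero[of "Suc k"] q_number_nonzero[of "Suc d"]
    by (simp add: q_binomial_def n q_factorial_Suc[of q k] q_factorial_Suc[of q d] Suc_diff_le divide_simps)
qed

section \<open>The three-term recurrence for h\<close>

lemma h_coeff_0 [simp]: "h_coeff q s n 0 = 1"
  by (simp add: h_coeff_def q_factorial_nonzero)

text \<open>With d = m - 2j, all three terms share a common factor, and what remains is [m+2] = [d]
  + q^d [2(j+1)], where [2(j+1)] = (1 + q^(j+1)) [j+1] cancels the extra denominators.\<close>

lemma h_coeff_Suc_Suc:
  "h_coeff q s (Suc (Suc m)) (Suc j)
    = h_coeff q s (Suc m) (Suc j) + q ^ Suc m * q_number q (Suc m) * s * h_coeff q s m j"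
proof (cases "2 * j \<le> m")
  case False
  then show ?thesis by (simp add: h_coeff_def)
next
  case True
  then obtain d where m: "m = 2 * j + d"
    using le_Suc_ex by blast
  define P where "P = (\<Prod>i=1..j. 1 + q ^ i)"
  have P: "P \<noteq> 0"
    unfolding P_def using one_plus_q_pow_nonzero by simp
  have P_Suc: "(\<Prod>i=1..Suc j. 1 + q ^ i) = (1 + q ^ Suc j) * P"
    by (simp add: P_def mult.commute)
  have pow: "q ^ Suc m * q ^ j\<^sup>2 = q ^ d * q ^ (Suc j)\<^sup>2"
    unfolding power_add[symmetric] by (rule arg_cong[of _ _ "(^) q"]) (simp add: m power2_eq_square)
  define B where "B = q_number q (Suc j)"
  define R where "R = 1 + q ^ Suc j"
  have "R \<noteq> 0" "B \<noteq> 0"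
    unfolding R_def B_def using one_plus_q_pow_nonzero[of "Suc j"] q_number_nonzero by simp_all
  note nz = this P q_factorial_nonzero[of j] q_factorial_nonzero[of d]
  define W where "W = q_factorial q (Suc m) * q ^ (Suc j)\<^sup>2 * s ^ Suc j"
  have "q_number q (Suc (Suc m)) = q_number q (d + 2 * Suc j)"
    by (simp add: m add.commute)
  also have "\<dots> = q_number q d + q ^ d * (R * B)"
    by (simp only: q_number_add q_number_double R_def B_def)
  finally have num: "q_number q (Suc (Suc m)) = q_number q d + q ^ d * (R * B)" .
  have lhs: "h_coeff q s (Suc (Suc m)) (Suc j)
      = W * q_number q (Suc (Suc m)) / (R * P * (B * q_factorial q j) * q_factorial q d)"
    unfolding h_coeff_def P_Suc R_def[symmetric] q_factorial_Suc[of q j] B_def[symmetric]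
    by (simp add: m W_def q_factorial_Suc[of q "Suc (2 * j + d)"])
  \<comment> \<open>For d = 0 the index j+1 lies beyond (m+1)/2, so the default 0 of
    \<open>h_coeff\<close> has to match the factor [0] on the right.\<close>
  have fst: "h_coeff q s (Suc m) (Suc j)
      = W * q_number q d / (R * P * (B * q_factorial q j) * q_factorial q d)"
  proof (cases d)
    case 0
    then show ?thesis by (simp add: h_coeff_def m)
  next
    case (Suc e)
    show ?thesis
      using q_number_nonzero[of "Suc e"] q_factorial_nonzero[of e]
      unfolding h_coeff_def P_Suc R_def[symmetric] q_factorial_Suc[of q j] B_def[symmetric]
      by (simp add: m Suc W_def q_factorial_Suc[of q e] ac_simps)
  qed
  have "q ^ Suc m * q_number q (Suc m) * s * h_coeff q s m j
      = (q ^ Suc m * q ^ j\<^sup>2) * q_factorial q (Suc m) * s ^ Suc j / (P * q_factorial q j * q_factorial q d)"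
    unfolding h_coeff_def P_def[symmetric] q_factorial_Suc[of q m]
    by (simp add: m)
  also have "\<dots> = W * q ^ d / (P * q_factorial q j * q_factorial q d)"
    unfolding pow by (simp add: W_def)
  finally have snd: "q ^ Suc m * q_number q (Suc m) * s * h_coeff q s m j
      = W * q ^ d / (P * q_factorial q j * q_factorial q d)" .
  show ?thesis
    unfolding lhs fst snd num using nz by (simp add: divide_simps) (simp add: algebra_simps)
qed

lemma h_poly_0 [simp]: "h_poly q s 0 = 1"
  by (simp add: h_poly_def)

lemma h_poly_1 [simp]: "h_poly q s (Suc 0) = [:0, 1:]"
  by (simp add: h_poly_def q_factorial_Suc monom_altdef)

lemma h_poly_Suc_Suc:
  "h_poly q s (Suc (Suc m))
    = pCons 0 (h_poly q s (Suc m)) + smult (q ^ Suc m * q_number q (Suc m) * s) (h_poly q s m)"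
proof -
  define c where "c = q ^ Suc m * q_number q (Suc m) * s"
  \<comment> \<open>Where truncated subtraction spoils the exponents, the coefficient is
    zero.\<close>
  have shift: "pCons 0 (monom (h_coeff q s (Suc m) (Suc j)) (Suc m - 2 * Suc j))
      = monom (h_coeff q s (Suc m) (Suc j)) (m - 2 * j)" for j
  proof (cases "2 * Suc j \<le> Suc m")
    case True
    then have "m - 2 * j = Suc (Suc m - 2 * Suc j)" by simp
    then show ?thesis by (simp only: monom_Suc)
  qed (simp add: h_coeff_def)
  have pCons_0_add: "pCons 0 (f + g) = pCons 0 f + pCons 0 g" for f g :: "'a poly"
    by simp
  have pCons_0_sum: "pCons 0 (sum g A) = (\<Sum>j\<in>A. pCons 0 (g j))" for g :: "nat \<Rightarrow> 'a poly" and A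
    by (induction A rule: infinite_finite_induct) (simp_all add: pCons_0_add del: add_pCons)
  have smult_sum: "smult c (sum g A) = (\<Sum>j\<in>A. smult c (g j))" for g :: "nat \<Rightarrow> 'a poly" and A
    by (induction A rule: infinite_finite_induct) (simp_all add: smult_add_right)
  \<comment> \<open>The leading term j = 0 is split off, since the coefficient recurrence starts at
    j = 1.\<close>
  have "h_poly q s (Suc (Suc m)) = monom 1 (Suc (Suc m))
      + (\<Sum>j\<le>Suc m. monom (h_coeff q s (Suc (Suc m)) (Suc j)) (m - 2 * j))"
    unfolding h_poly_eq_sum[OF order_refl, of q s "Suc (Suc m)"] sum.atMost_Suc_shift[of _ "Suc m"]
    by simp
  also have "\<dots> = (monom 1 (Suc (Suc m))
      + (\<Sum>j\<le>Suc m. monom (h_coeff q s (Suc m) (Suc j)) (m - 2 * j)))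
      + (\<Sum>j\<le>Suc m. monom (c * h_coeff q s m j) (m - 2 * j))"
    unfolding h_coeff_Suc_Suc c_def[symmetric] add_monom[symmetric] sum.distrib
    by (simp only: add.assoc)
  also have "(monom 1 (Suc (Suc m))
      + (\<Sum>j\<le>Suc m. monom (h_coeff q s (Suc m) (Suc j)) (m - 2 * j))) = pCons 0 (h_poly q s (Suc m))"
    unfolding h_poly_eq_sum[of "Suc m" "Suc (Suc m)" q s, OF le_SucI[OF order_refl]]
      sum.atMost_Suc_shift[of _ "Suc m"] pCons_0_sum shift[symmetric]
    by (simp add: monom_Suc pCons_0_sum pCons_0_add del: add_pCons sum.atMost_Suc)
  also have "(\<Sum>j\<le>Suc m. monom (c * h_coeff q s m j) (m - 2 * j)) = smult c (h_poly q s m)"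
    unfolding h_poly_eq_sum[of m "Suc m" q s, OF le_SucI[OF order_refl]]
    by (simp add: smult_sum smult_monom del: sum.atMost_Suc)
  finally show ?thesis
    by (simp only: c_def)
qed

text \<open>The case m = 0 is included because [0] = 0 removes the meaningless term with index
  \<open>m - 1\<close>.\<close>

lemma h_poly_Suc:
  "h_poly q s (Suc m)
    = pCons 0 (h_poly q s m) + smult (q ^ m * q_number q m * s) (h_poly q s (m - 1))"
  by (cases m) (simp_all add: h_poly_Suc_Suc one_pCons del: power_Suc)

text \<open>The three terms arise from a_k (sD)^k X, from the commutator in a_(k+1) (sD)^(k+1) X,
  and from a_(k-1) (sD)^(k-1) times q^(2n+1) sD. The first two combine by absorption and the
  recurrence for h; the third joins them by the q-Pascal rule.\<close>

lemma op_coeff_Suc: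
  "op_coeff q s (Suc n) k = smult (q ^ k) (pCons 0 (op_coeff q s n k))
    + smult (s * q_number q (Suc k)) (op_coeff q s n (Suc k))
    + (if k = 0 then 0 else smult (q ^ (2 * n + 1)) (op_coeff q s n (k - 1)))"
proof (cases "k \<le> n")
  case False
  show ?thesis
  proof (cases "k = Suc n")
    case True
    \<comment> \<open>Only the third term survives, and n^2 + (2n+1) = (n+1)^2.\<close>
    then show ?thesis
      by (simp add: op_coeff_def mult_2 flip: power_add power_Suc) (simp add: algebra_simps)
  qed (use False in \<open>simp add: op_coeff_def\<close>)
next
  case True
  define m where "m = n - k"
  have n: "n = m + k"
    using True by (simp add: m_def)
  define b where "b = q_binomial q n k"
  have second: "smult (s * q_number q (Suc k)) (op_coeff q s n (Suc k))
      = smult (b * q ^ (k * Suc n)) (smult (q ^ m * q_number q m * s) (h_poly q s (m - 1)))"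
  proof (cases m)
    case 0
    then show ?thesis by (simp add: op_coeff_def n)
  next
    case (Suc d)
    then have absorb: "q_binomial q n (Suc k) * q_number q (Suc k) = b * q_number q m"
      using q_binomial_absorb[of k n] n by (simp add: b_def)
    \<comment> \<open>As n = m + k, (k+1)n = k(n+1) + m; this supplies the q^m of the
      recurrence.\<close>
    have pow: "q ^ (Suc k * n) = q ^ (k * Suc n) * q ^ m"
      by (simp add: n algebra_simps flip: power_add)
    have "smult (s * q_number q (Suc k)) (op_coeff q s n (Suc k))
        = smult (s * q ^ (Suc k * n) * (q_binomial q n (Suc k) * q_number q (Suc k))) (h_poly q s (m - 1))"
      using Suc by (simp add: op_coeff_def n ac_simps)
    then show ?thesis
      unfolding absorb pow by (simp add: ac_simps)
  qed
  have first: "smult (q ^ k) (pCons 0 (op_coeff q s n k))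
      = smult (b * q ^ (k * Suc n)) (pCons 0 (h_poly q s m))"
    by (simp add: op_coeff_def n b_def power_add ac_simps)
  have first_second: "smult (q ^ k) (pCons 0 (op_coeff q s n k))
      + smult (s * q_number q (Suc k)) (op_coeff q s n (Suc k))
      = smult (b * q ^ (k * Suc n)) (h_poly q s (Suc m))"
    unfolding first second smult_add_right[symmetric] h_poly_Suc ..
  show ?thesis
  proof (cases k)
    case 0
    then show ?thesis
      unfolding first_second by (simp add: op_coeff_def b_def n)
  next
    case (Suc l)
    \<comment> \<open>The spare factor q^(m+1) is the weight q^(n-l) in the q-Pascal rule.\<close>
    have pow: "q ^ (2 * n + 1) * q ^ (l * n) = q ^ Suc m * q ^ (k * Suc n)"
      unfolding power_add[symmetric] by (rule arg_cong[of _ _ "(^) q"]) (simp add: n Suc)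
    have "smult (q ^ (2 * n + 1)) (op_coeff q s n l)
        = smult (q_binomial q n l * (q ^ (2 * n + 1) * q ^ (l * n))) (h_poly q s (Suc m))"
      by (simp add: op_coeff_def n Suc ac_simps)
    then have "smult (q ^ (2 * n + 1)) (op_coeff q s n l)
        = smult (q ^ Suc m * q_binomial q n l * q ^ (k * Suc n)) (h_poly q s (Suc m))"
      unfolding pow by (simp only: ac_simps)
    moreover have "q_binomial q (Suc n) k = b + q ^ Suc m * q_binomial q n l"
      using q_binomial_Suc_Suc[of l n] by (simp add: n Suc b_def)
    moreover have "op_coeff q s (Suc n) k
        = smult (q_binomial q (Suc n) k * q ^ (k * Suc n)) (h_poly q s (Suc m))"
      by (simp add: op_coeff_def n)
    ultimately show ?thesis
      unfolding first_second
      by (simp only: Suc diff_Suc_1 nat.distinct if_False smult_add_left[symmetric] distrib_right)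
  qed
qed

text \<open>The new rightmost factor acts first, so the induction hypothesis is used at its image of
  f; hence f is arbitrary.\<close>

lemma op_prod_expansion:
  assumes "q \<noteq> 1"
  shows "op_prod (map (\<lambda>i f. mult_op [:0, 1:] f + smult (q ^ (2 * i - 1) * s) (q_diff q f)) [1..<Suc n]) f
    = (\<Sum>k\<le>n. op_coeff q s n k * (scaled_q_diff q s ^^ k) f)"
proof (induction n arbitrary: f)
  case 0
  then show ?case by (simp add: op_prod_def op_coeff_def)
next
  case (Suc n)
  define a where "a = op_coeff q s n"
  define u where "u = (\<lambda>k. (scaled_q_diff q s ^^ k) f)"
  define c where "c = q ^ (2 * n + 1)"
  have a_0: "a k = 0" if "k > n" for k
    using that by (simp add: a_def op_coeff_def)
  have op_prod_snoc: "op_prod (Ts @ [T]) f = op_prod Ts (T f)" for Ts and T :: "'a poly \<Rightarrow> 'a poly"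
    unfolding op_prod_def by (induction Ts) simp_all
  have u: "(scaled_q_diff q s ^^ k) (pCons 0 f + smult c (scaled_q_diff q s f))
      = smult (q ^ k) (pCons 0 (u k)) + smult (s * q_number q k) (u (k - 1)) + smult c (u (Suc k))" for k
    unfolding scaled_q_diff_pow_add[OF assms] scaled_q_diff_pow_smult[OF assms]
      scaled_q_diff_pow_pCons_0[OF assms] u_def
    by (simp add: funpow_swap1)
  have "op_prod (map (\<lambda>i f. mult_op [:0, 1:] f + smult (q ^ (2 * i - 1) * s) (q_diff q f)) [1..<Suc (Suc n)]) f
      = op_prod (map (\<lambda>i f. mult_op [:0, 1:] f + smult (q ^ (2 * i - 1) * s) (q_diff q f)) [1..<Suc n])
          (pCons 0 f + smult c (scaled_q_diff q s f))"
    by (subst upt_Suc) (simp add: op_prod_snoc mult_op_def c_def scaled_q_diff_def del: upt_Suc)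
  also have "\<dots> = (\<Sum>k\<le>n. a k *
      (smult (q ^ k) (pCons 0 (u k)) + smult (s * q_number q k) (u (k - 1)) + smult c (u (Suc k))))"
    unfolding Suc.IH u a_def ..
  also have "\<dots> = (\<Sum>k\<le>n. smult (q ^ k) (pCons 0 (a k)) * u k)
      + (\<Sum>k\<le>n. smult (s * q_number q k) (a k) * u (k - 1))
      + (\<Sum>k\<le>n. smult c (a k) * u (Suc k))"
    by (simp add: distrib_left sum.distrib)
  \<comment> \<open>The three sums are brought to the common range k \<le> n+1 and indexed by the
    power of sD. Padding uses a_k = 0 for k > n; in the second sum the term k = 0, lost in the
    shift, vanishes by [0] = 0.\<close>
  also have "(\<Sum>k\<le>n. smult (q ^ k) (pCons 0 (a k)) * u k)
      = (\<Sum>k\<le>Suc n. smult (q ^ k) (pCons 0 (a k)) * u k)"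
    by (simp add: a_0)
  also have "(\<Sum>k\<le>n. smult (s * q_number q k) (a k) * u (k - 1))
      = (\<Sum>k\<le>Suc (Suc n). smult (s * q_number q k) (a k) * u (k - 1))"
    by (simp add: a_0)
  also have "\<dots> = (\<Sum>k\<le>Suc n. smult (s * q_number q (Suc k)) (a (Suc k)) * u k)"
    by (subst sum.atMost_Suc_shift) simp
  also have "(\<Sum>k\<le>n. smult c (a k) * u (Suc k))
      = (\<Sum>k\<le>Suc n. (if k = 0 then 0 else smult c (a (k - 1))) * u k)"
    by (subst sum.atMost_Suc_shift) simp
  finally show ?case
    unfolding op_coeff_Suc a_def[symmetric] u_def[symmetric] c_def[symmetric]
    by (simp only: distrib_right sum.distrib u_def)
qed

end

section \<open>Specialisation to the indeterminate q\<close>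

lemma q_number_indet_nonzero:
  assumes "n > 0"
  shows "q_number (q_indet :: 'k::field poly poly fract) n \<noteq> 0"
proof
  assume "q_number (q_indet :: 'k poly poly fract) n = 0"
  moreover have "(q_indet :: 'k poly poly fract) ^ i = to_fract [:[:0, 1:] ^ i:]" for i
    by (induction i) (simp_all add: q_indet_def to_fract_mult[symmetric] one_pCons[symmetric] del: to_fract_mult)
  ultimately have "to_fract (\<Sum>i<n. [:[:0, 1 :: 'k:] ^ i:]) = 0"
    by (simp add: q_number_def to_fract_sum)
  \<comment> \<open>The constant term in both s and q is 1, coming from i = 0 alone.\<close>
  then have "coeff (coeff (\<Sum>i<n. [:[:0, 1 :: 'k:] ^ i:]) 0) 0 = 0"
    by (simp only: to_fract_eq_0_iff coeff_0)
  moreover have "coeff (coeff (\<Sum>i<n. [:[:0, 1 :: 'k:] ^ i:]) 0) 0 = (\<Sum>i<n. 0 ^ i)"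
    by (simp add: coeff_sum coeff_0_power)
  ultimately show False
    using assms by (cases n) (simp_all add: sum.lessThan_Suc_shift del: sum.lessThan_Suc)
qed

theorem theorem3:
  fixes q s :: "'k::field poly poly fract" and n :: nat
  assumes "q = q_indet" and "s = s_indet"
  shows "op_prod (map (\<lambda>i f. mult_op [:0, 1:] f + smult (q ^ (2 * i - 1) * s) (q_diff q f)) [1..<Suc n])
    = (\<lambda>f. \<Sum>k=0..n. smult (q_binomial q n k * q ^ (k * n))
        (mult_op (h_poly q s (n - k)) (((\<lambda>g. smult s (q_diff q g)) ^^ k) f)))"
proof
  fix f
  have q_number: "q_number q n \<noteq> 0" if "n > 0" for n
    using q_number_indet_nonzero[OF that] assms by simp
  have "(\<lambda>g. smult s (q_diff q g)) = scaled_q_diff q s"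
    by (simp add: scaled_q_diff_def fun_eq_iff)
  then show "op_prod (map (\<lambda>i f. mult_op [:0, 1:] f + smult (q ^ (2 * i - 1) * s) (q_diff q f)) [1..<Suc n]) f
    = (\<Sum>k=0..n. smult (q_binomial q n k * q ^ (k * n))
        (mult_op (h_poly q s (n - k)) (((\<lambda>g. smult s (q_diff q g)) ^^ k) f)))"
    using op_prod_expansion[OF q_number, of s n f] q_indet_neq_1 assms(1)
    by (simp add: atMost_atLeast0 op_coeff_def mult_op_def del: upt_Suc)
qed

end
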